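(* Let $\mathcal S$ be any collection (of arbitrary cardinality) of random variables whose laws are all absolutely continuous with respect to a common $\sigma$-finite measure. Then there exists a coupling of the variables in $\mathcal S$ such that, for any $X,Y\in\mathcal S$, $$\mathbb P(X\neq Y)\le \frac{2\,d_{\mathrm{TV}}(X,Y)}{1+d_{\mathrm{TV}}(X,Y)}.$$
   Context: A coupling of a collection of random variables $(X_i)_{i\in I}$ is a family of random variables $(X_i')_{i\in I}$ defined on one common probability space such that, for each $i\in I$, $X_i'$ has the same law as $X_i$. The primes are omitted: in a coupling, $\mathbb P(X\ne Y)$ denotes the probability that the corresponding variables $X',Y'$ differ on the common probability space. The total variation distance is $d_{\mathrm{TV}}(X,Y)=\sup_A|\mathbb P(X\in A)-\mathbb P(Y\in A)|$, the supremum being over all measurable sets $A$; it depends only on the laws of $X$ and $Y$. *)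

theory Defs
  imports "HOL-Probability.Probability"
begin

definition tv_dist ::
  "'a measure \<Rightarrow> 'v measure \<Rightarrow> ('v \<Rightarrow> 'a) \<Rightarrow> 'w measure \<Rightarrow> ('w \<Rightarrow> 'a) \<Rightarrow> real" where
  "tv_dist E P X Q Y =
     (SUP A\<in>sets E. \<bar>\<P>(\<omega> in P. X \<omega> \<in> A) - \<P>(\<omega> in Q. Y \<omega> \<in> A)\<bar>)"

text \<open>The given variables \<open>X i\<close> need not live on a common probability space:
  \<open>X i\<close> is defined on \<open>P i\<close>. All of them take values in the measurable space \<open>E\<close>.\<close>

definition is_coupling ::
  "'i set \<Rightarrow> 'a measure \<Rightarrow> ('i \<Rightarrow> 'w measure) \<Rightarrow> ('i \<Rightarrow> 'w \<Rightarrow> 'a) \<Rightarrow>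
   'v measure \<Rightarrow> ('i \<Rightarrow> 'v \<Rightarrow> 'a) \<Rightarrow> bool" where
  "is_coupling I E P X N X' \<longleftrightarrow>
     prob_space N \<and>
     (\<forall>i\<in>I. X' i \<in> N \<rightarrow>\<^sub>M E \<and> distr N E (X' i) = distr (P i) E (X i))"

text \<open>HOL cannot quantify existentially over the type of the common probability space, so
  an existence statement must fix a type of outcomes. The type \<open>'i \<Rightarrow> 'a\<close>, with an arbitrary
  \<open>\<sigma>\<close>-algebra on it, loses no generality: any coupling \<open>(N, X')\<close> on any type can be pushed
  forward along \<open>\<lambda>\<omega> i. X' i \<omega>\<close> to the \<open>\<sigma>\<close>-algebra of all sets with measurable preimage,
  which turns the variables into coordinate maps and keeps all their events measurable.\<close>

end

theory Submission
  imports Defs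
begin

text \<open>
  All variables read off the same Poisson process of rate one in time on \<open>E \<times> [0, \<infinity>)\<close>, with
  intensity \<open>\<nu> \<times> Lebesgue\<close> for a probability measure \<open>\<nu>\<close> equivalent to \<open>\<mu>\<close>: a variable with
  density \<open>f\<close> is the position of the first point below the graph of \<open>f\<close>. If the first point below
  \<open>max f g\<close> lies below \<open>min f g\<close>, then it is the first point for both \<open>f\<close> and \<open>g\<close>. With
  \<open>c = \<integral> max f g\<close> this happens with probability \<open>(2 - c) / c\<close>, and \<open>c \<le> 1 + d\<close> for the total
  variation distance \<open>d\<close>, so the variables differ with probability at most
  \<open>2 - 2 / (1 + d) = 2 d / (1 + d)\<close>.

  The height axis is cut into strips of unit length, so that each strip has finite rate and the
  first point is the winner of a race between independent exponential clocks. Since the diagonal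
  of \<open>E\<close> need not be measurable, the position is finally replaced by a representative under a
  measurable equivalence relation that is fine enough not to change any law.
\<close>

section \<open>Exponential gaps\<close>

lemma indep_vars_PiM_coords:
  assumes "\<And>i. i \<in> I \<Longrightarrow> prob_space (M i)" and "I \<noteq> {}"
  shows "prob_space.indep_vars (PiM I M) M (\<lambda>i \<omega>. \<omega> i) I"
proof -
  interpret prob_space "PiM I M" by (rule prob_space_PiM) fact
  have "distr (PiM I M) (PiM I M) (\<lambda>x. \<lambda>i\<in>I. x i) = distr (PiM I M) (PiM I M) (\<lambda>x. x)"
    by (rule distr_cong) (auto simp: space_PiM)
  also have "\<dots> = PiM I (\<lambda>i. distr (PiM I M) (M i) (\<lambda>x. x i))"
    unfolding distr_id by (rule PiM_cong) (simp_all add: distr_PiM_component assms(1))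
  finally show ?thesis
    using assms(2) by (subst indep_vars_iff_distr_eq_PiM') simp_all
qed

definition exp_law :: "real measure" where
  "exp_law = density lborel (exponential_density 1)"

lemma sets_exp_law [measurable_cong, simp]: "sets exp_law = sets borel"
  by (simp add: exp_law_def)

lemma space_exp_law [simp]: "space exp_law = UNIV"
  by (simp add: exp_law_def)

lemma prob_space_exp_law: "prob_space exp_law"
  unfolding exp_law_def by (rule prob_space_exponential_density) simp

abbreviation gaps :: "(nat \<Rightarrow> real) measure" where
  "gaps \<equiv> PiM UNIV (\<lambda>_. exp_law)"

lemma prob_space_gaps: "prob_space gaps"
  by (intro prob_space_PiM prob_space_exp_law)

lemma AE_gaps_nonneg: "AE s in gaps. \<forall>n. 0 \<le> s n"
proof -
  have "AE x in exp_law. 0 \<le> x"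
    unfolding exp_law_def by (subst AE_density) (auto simp: exponential_density_def)
  then show ?thesis
    unfolding AE_all_countable
    by (intro allI AE_PiM_component[where P = "\<lambda>x. 0 \<le> x"] prob_space_exp_law) auto
qed

lemma indep_vars_gaps: "prob_space.indep_vars gaps (\<lambda>_. borel) (\<lambda>n s. s n) {..m::nat}"
proof -
  interpret prob_space gaps by (rule prob_space_gaps)
  have "indep_vars (\<lambda>_. exp_law) (\<lambda>n s. s n) (UNIV::nat set)"
    by (rule indep_vars_PiM_coords) (auto intro: prob_space_exp_law)
  then have "indep_vars (\<lambda>_. exp_law) (\<lambda>n s. s n) {..m}"
    by (rule indep_vars_subset) simp
  from indep_vars_compose2[OF this, of "\<lambda>_ x. x" "\<lambda>_. borel"] show ?thesis
    by simp
qed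

lemma distributed_gaps: "distributed gaps lborel (\<lambda>s. s n) (exponential_density 1)"
proof -
  have "distr gaps lborel (\<lambda>s. s n) = distr gaps exp_law (\<lambda>s. s n)"
    by (rule distr_cong) simp_all
  also have "\<dots> = exp_law"
    by (rule distr_PiM_component) (auto intro: prob_space_exp_law)
  finally show ?thesis
    by (auto simp: distributed_def exp_law_def)
qed

lemma prob_arrival_le:
  assumes "0 \<le> t"
  shows "measure gaps {s \<in> space gaps. (\<Sum>m\<le>n. s m) \<le> t} = erlang_CDF n 1 t"
proof -
  interpret prob_space gaps by (rule prob_space_gaps)
  have "distributed gaps lborel (\<lambda>s. \<Sum>m\<in>{..n}. s m) (erlang_density (card {..n} - 1) 1)"
    by (rule exponential_distributed_sum) (auto intro: distributed_gaps indep_vars_gaps)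
  then have "distributed gaps lborel (\<lambda>s. \<Sum>m\<le>n. s m) (erlang_density n 1)"
    by simp
  from erlang_distributed_le[OF this _ assms] show ?thesis by simp
qed

lemma nn_integral_exp_law:
  assumes "0 \<le> c"
  shows "(\<integral>\<^sup>+x. ennreal (exp (- c * x)) \<partial>exp_law) = ennreal (1 / (1 + c))"
proof -
  \<comment> \<open>Tilting by \<open>exp (- c * x)\<close> gives the exponential density of rate
    \<open>1 + c\<close>, up to a constant factor.\<close>
  have eq: "exponential_density 1 x * exp (- c * x) = 1 / (1 + c) * exponential_density (1 + c) x" for x
  proof -
    have "exp (- x * (1 + c)) = exp (- x) * exp (- c * x)"
      by (simp add: exp_add[symmetric] algebra_simps)
    then show ?thesis
      using assms by (simp add: exponential_density_def)
  qed
  have "(\<integral>\<^sup>+x. ennreal (exp (- c * x)) \<partial>exp_law)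
      = (\<integral>\<^sup>+x. ennreal (1 / (1 + c)) * ennreal (exponential_density (1 + c) x) \<partial>lborel)"
    unfolding exp_law_def
    using assms by (subst nn_integral_density)
      (auto intro!: nn_integral_cong simp: ennreal_mult[symmetric] eq[simplified])
  also have "\<dots> = ennreal (1 / (1 + c)) * (\<integral>\<^sup>+x. ennreal (exponential_density (1 + c) x) \<partial>lborel)"
    by (rule nn_integral_cmult) simp
  also have "(\<integral>\<^sup>+x. ennreal (exponential_density (1 + c) x) \<partial>lborel) = 1"
    using nn_integral_erlang_ith_moment[of "1 + c" 0 0] assms by simp
  finally show ?thesis by simp
qed

text \<open>Needed with \<open>c\<close> the total rate of the competing strips:
  \<open>exp (- c * t)\<close> is the chance that they stay silent up to time \<open>t\<close>,
  averaged here over the arrival time of point \<open>n\<close>. Independence of the gaps makes the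
  mean factorise.\<close>

lemma nn_integral_exp_arrival:
  assumes "0 \<le> c"
  shows "(\<integral>\<^sup>+s. ennreal (exp (- c * (\<Sum>m\<le>n. s m))) \<partial>gaps) = ennreal ((1 / (1 + c)) ^ Suc n)"
proof -
  interpret prob_space gaps by (rule prob_space_gaps)
  have "(\<integral>\<^sup>+s. ennreal (exp (- c * (\<Sum>m\<le>n. s m))) \<partial>gaps)
      = (\<integral>\<^sup>+s. (\<Prod>m\<in>{..n}. ennreal (exp (- c * s m))) \<partial>gaps)"
    by (intro nn_integral_cong)
      (simp add: prod_ennreal exp_sum sum_distrib_left sum_negf[symmetric] del: sum_negf)
  also have "\<dots> = (\<Prod>m\<in>{..n}. \<integral>\<^sup>+s. ennreal (exp (- c * s m)) \<partial>gaps)"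
    using indep_vars_compose2[OF indep_vars_gaps[of n], of "\<lambda>_ x. ennreal (exp (- c * x))" "\<lambda>_. borel"]
    by (intro indep_vars_nn_integral) auto
  also have "\<dots> = (\<Prod>m\<in>{..n}. ennreal (1 / (1 + c)))"
  proof (rule prod.cong[OF refl])
    fix m :: nat
    have "(\<integral>\<^sup>+s. ennreal (exp (- c * s m)) \<partial>gaps)
        = (\<integral>\<^sup>+x. ennreal (exp (- c * x)) \<partial>distr gaps exp_law (\<lambda>s. s m))"
      by (subst nn_integral_distr) auto
    also have "distr gaps exp_law (\<lambda>s. s m) = exp_law"
      by (rule distr_PiM_component) (auto intro: prob_space_exp_law)
    finally show "(\<integral>\<^sup>+s. ennreal (exp (- c * s m)) \<partial>gaps) = ennreal (1 / (1 + c))"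
      by (simp only: nn_integral_exp_law[OF assms])
  qed
  also have "\<dots> = ennreal ((1 / (1 + c)) ^ Suc n)"
    using assms by (simp add: prod_ennreal ennreal_power ennreal_mult[symmetric])
  finally show ?thesis .
qed

text \<open>Thinning of a rate-one Poisson process: if each point is kept with probability
  \<open>p\<close>, the first kept point has a geometric index and arrives by \<open>t\<close> with
  the probability on the right. Inserting the Poisson sum from \<open>erlang_CDF\<close> leaves a
  geometric series minus its Cauchy product with an exponential series.\<close>

lemma geometric_erlang_sums:
  fixes p t :: real
  assumes "0 \<le> p" "p \<le> 1" "0 \<le> t"
  shows "(\<lambda>n. (1 - p) ^ n * p * erlang_CDF n 1 t) sums (1 - exp (- p * t))"
proof (cases "p = 0")
  \<comment> \<open>For \<open>p = 0\<close> the geometric series below does not sum to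
    \<open>1\<close>, but all terms and the limit vanish.\<close>
  case False
  then have p: "\<bar>1 - p\<bar> < 1" using assms by auto
  have geo: "(\<lambda>n. p * (1 - p) ^ n) sums 1"
    using sums_mult[OF geometric_sums[of "1 - p"], of p] p False by simp
  have sg: "summable (\<lambda>n. norm (p * (1 - p) ^ n))"
    using geo assms by (simp add: sums_iff abs_mult)
  \<comment> \<open>The weight \<open>(1 - p) ^ n\<close> is split as
    \<open>(1 - p) ^ i * (1 - p) ^ (n - i)\<close>; the first factor goes into
    \<open>a\<close>.\<close>
  define a where "a = (\<lambda>m. exp (- t) * (((1 - p) * t) ^ m /\<^sub>R fact m))"
  have a: "a sums (exp (- t) * exp ((1 - p) * t))"
    unfolding a_def by (intro sums_mult exp_converges)
  have sa: "summable (\<lambda>m. norm (a m))"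
    using a assms by (simp add: sums_iff a_def abs_mult)
  have "(\<lambda>n. \<Sum>i\<le>n. a i * (p * (1 - p) ^ (n - i))) sums (exp (- t) * exp ((1 - p) * t) * 1)"
    using Cauchy_product_sums[OF sa sg] a geo by (simp add: sums_iff)
  also have "exp (- t) * exp ((1 - p) * t) * 1 = exp (- p * t)"
    by (simp add: exp_add[symmetric] algebra_simps)
  finally have "(\<lambda>n. p * (1 - p) ^ n - (\<Sum>i\<le>n. a i * (p * (1 - p) ^ (n - i)))) sums (1 - exp (- p * t))"
    by (intro sums_diff geo)
  moreover have "p * (1 - p) ^ n - (\<Sum>i\<le>n. a i * (p * (1 - p) ^ (n - i))) =
      (1 - p) ^ n * p * erlang_CDF n 1 t" for n
  proof -
    have "(\<Sum>i\<le>n. a i * (p * (1 - p) ^ (n - i))) = (\<Sum>i\<le>n. (1 - p) ^ n * p * (t ^ i * exp (- t) / fact i))"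
    proof (rule sum.cong[OF refl])
      fix i assume "i \<in> {..n}"
      then have "(1 - p) ^ i * (1 - p) ^ (n - i) = (1 - p) ^ n"
        by (simp add: power_add[symmetric])
      moreover have "a i * (p * (1 - p) ^ (n - i)) =
          ((1 - p) ^ i * (1 - p) ^ (n - i)) * p * (t ^ i * exp (- t) / fact i)"
        by (simp add: a_def power_mult_distrib divide_inverse mult_ac)
      ultimately show "a i * (p * (1 - p) ^ (n - i)) = (1 - p) ^ n * p * (t ^ i * exp (- t) / fact i)"
        by simp
    qed
    also have "\<dots> = (1 - p) ^ n * p * (\<Sum>i\<le>n. t ^ i * exp (- t) / fact i)"
      by (rule sum_distrib_left[symmetric])
    finally show ?thesis
      using assms by (simp add: erlang_CDF_def right_diff_distrib)
  qed
  ultimately show ?thesis by simp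
qed simp

section \<open>Races between Poisson processes\<close>

text \<open>A strip pairs a sequence of marks with a sequence of exponential gaps; it encodes a rate-one
  Poisson process in time whose \<open>n\<close>-th point carries the \<open>n\<close>-th mark and arrives at the \<open>n\<close>-th
  partial sum of the gaps.\<close>

type_synonym 'b marked = "(nat \<Rightarrow> 'b) \<times> (nat \<Rightarrow> real)"

definition arrival :: "'b marked \<Rightarrow> nat \<Rightarrow> real" where
  "arrival w n = (\<Sum>m\<le>n. snd w m)"

definition waits :: "'b set \<Rightarrow> real \<Rightarrow> 'b marked \<Rightarrow> bool" where
  "waits A t w \<longleftrightarrow> (\<forall>m. fst w m \<in> A \<longrightarrow> t < arrival w m)"

text \<open>Two sets, because the race is run for \<open>A\<close> while the event also asks where
  its first point lies; in the applications \<open>C \<subseteq> A\<close>.\<close>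

definition hits :: "'b set \<Rightarrow> 'b set \<Rightarrow> nat \<Rightarrow> (nat \<Rightarrow> 'b) \<Rightarrow> bool" where
  "hits A C n y \<longleftrightarrow> y n \<in> C \<and> (\<forall>m<n. y m \<notin> A)"

lemma hits_unique: "hits A C n y \<Longrightarrow> hits A C n' y \<Longrightarrow> C \<subseteq> A \<Longrightarrow> n = n'"
  unfolding hits_def by (metis linorder_neqE_nat subsetD)

lemma hits_exists:
  assumes "y m \<in> A"
  obtains n where "n \<le> m" "hits A A n y"
proof
  show "(LEAST n. y n \<in> A) \<le> m" "hits A A (LEAST n. y n \<in> A) y"
    using assms by (auto simp: hits_def intro: Least_le LeastI dest: not_less_Least)
qed

lemma arrival_mono:
  assumes "\<forall>n. 0 \<le> snd w n" "m \<le> n"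
  shows "arrival w m \<le> arrival w n"
  unfolding arrival_def using assms by (intro sum_mono2) auto

abbreviation marks :: "'b measure \<Rightarrow> (nat \<Rightarrow> 'b) measure" where
  "marks L \<equiv> PiM UNIV (\<lambda>_. L)"

abbreviation strip :: "'b measure \<Rightarrow> 'b marked measure" where
  "strip L \<equiv> marks L \<Otimes>\<^sub>M gaps"

abbreviation strips :: "'b measure \<Rightarrow> (nat \<Rightarrow> 'b marked) measure" where
  "strips L \<equiv> PiM UNIV (\<lambda>_. strip L)"

lemma measurable_arrival [measurable]: "(\<lambda>w. arrival w n) \<in> borel_measurable (strip L)"
  unfolding arrival_def by measurable

lemma pred_hits [measurable]:
  assumes [measurable]: "A \<in> sets L" "C \<in> sets L"
  shows "Measurable.pred (marks L) (hits A C n)"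
  unfolding hits_def[abs_def] by measurable

lemma pred_waits [measurable (raw)]:
  assumes [measurable]: "A \<in> sets L" "f \<in> borel_measurable N" "g \<in> N \<rightarrow>\<^sub>M strip L"
  shows "Measurable.pred N (\<lambda>x. waits A (f x) (g x))"
  unfolding waits_def by measurable

context prob_space
begin

lemma prob_space_marks: "prob_space (marks M)"
  by (intro prob_space_PiM) unfold_locales

lemma prob_space_strip: "prob_space (strip M)"
  by (intro prob_space_pair prob_space_marks prob_space_gaps)

lemma prob_space_strips: "prob_space (strips M)"
  by (intro prob_space_PiM prob_space_strip)

lemma prob_hits:
  assumes [measurable]: "A \<in> events" "C \<in> events"
  shows "measure (marks M) {y \<in> space (marks M). hits A C n y} = (1 - prob A) ^ n * prob C"
proof -
  interpret S: sequence_space M by unfold_locales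
  let ?E = "\<lambda>m. if m = n then C else space M - A"
  have "{y \<in> space (marks M). hits A C n y} = {y \<in> space (marks M). \<forall>m\<in>{..n}. y m \<in> ?E m}"
    by (intro Collect_cong) (auto simp: hits_def space_PiM PiE_iff le_less)
  then have "emeasure (marks M) {y \<in> space (marks M). hits A C n y} = (\<Prod>m\<in>{..n}. emeasure M (?E m))"
    by (simp only:) (intro S.emeasure_PiM_Collect, auto)
  also have "{..n} = insert n {..<n}" by auto
  also have "(\<Prod>m\<in>insert n {..<n}. emeasure M (?E m)) = emeasure M C * (\<Prod>m<n. emeasure M (space M - A))"
    by (subst prod.insert) (auto intro!: prod.cong arg_cong2[where f = "(*)"])
  also have "\<dots> = ennreal ((1 - prob A) ^ n * prob C)"
    by (simp add: emeasure_eq_measure prob_compl ennreal_power ennreal_mult[symmetric] mult.commute)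
  finally show ?thesis
    by (simp add: S.P.emeasure_eq_measure)
qed

lemma AE_strip_nonneg: "AE w in strip M. \<forall>n. 0 \<le> snd w n"
proof -
  interpret G: prob_space gaps by (rule prob_space_gaps)
  interpret Y: prob_space "marks M" by (rule prob_space_marks)
  interpret P: pair_sigma_finite "marks M" gaps by unfold_locales
  have "{w \<in> space (strip M). \<forall>n. 0 \<le> snd w n} \<in> sets (strip M)"
    by measurable
  then show ?thesis
    using AE_gaps_nonneg by (intro P.AE_pair_measure) simp_all
qed

text \<open>The points with mark in \<open>A\<close> form a Poisson process of rate
  \<open>prob A\<close>. Marks and gaps are independent, so the chance that the first of these
  points arrives by \<open>t\<close> is the series in \<open>geometric_erlang_sums\<close>.\<close>

lemma prob_waits:
  assumes [measurable]: "A \<in> events" and t: "0 \<le> t"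
  shows "measure (strip M) {w \<in> space (strip M). waits A t w} = exp (- prob A * t)"
proof -
  interpret S: prob_space "strip M" by (rule prob_space_strip)
  interpret G: prob_space gaps by (rule prob_space_gaps)
  interpret Y: prob_space "marks M" by (rule prob_space_marks)
  define H where "H n = {w \<in> space (strip M). hits A A n (fst w) \<and> arrival w n \<le> t}" for n
  have H[measurable]: "H n \<in> sets (strip M)" for n
    unfolding H_def by measurable
  have mH: "measure (strip M) (H n) = (1 - prob A) ^ n * prob A * erlang_CDF n 1 t" for n
  proof -
    have eq: "H n = {y \<in> space (marks M). hits A A n y} \<times> {s \<in> space gaps. (\<Sum>m\<le>n. s m) \<le> t}"
      by (auto simp: H_def space_pair_measure arrival_def)
    show ?thesis
      unfolding eq
      by (subst measure_def, subst G.emeasure_pair_measure_Times)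
        (simp_all add: enn2real_mult measure_def[symmetric] prob_hits prob_arrival_le t)
  qed
  have disj: "disjoint_family H"
    by (auto simp: disjoint_family_on_def H_def dest: hits_unique)
  have "(\<lambda>n. measure (strip M) (H n)) sums measure (strip M) (\<Union>n. H n)"
    by (rule S.finite_measure_UNION) (use disj in auto)
  moreover have "(\<lambda>n. measure (strip M) (H n)) sums (1 - exp (- prob A * t))"
    unfolding mH by (rule geometric_erlang_sums) (use t in auto)
  ultimately have U: "measure (strip M) (\<Union>n. H n) = 1 - exp (- prob A * t)"
    by (rule sums_unique2)
  \<comment> \<open>With nonnegative gaps the arrival times do not decrease, so only the first point
    in \<open>A\<close> matters.\<close>
  from AE_strip_nonneg have "AE w in strip M. w \<in> {w \<in> space (strip M). waits A t w} \<longleftrightarrow> w \<in> space (strip M) - (\<Union>n. H n)"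
  proof (rule AE_mp, intro AE_I2 impI)
    fix w assume w: "w \<in> space (strip M)" and nn: "\<forall>n. 0 \<le> snd w n"
    have "waits A t w \<longleftrightarrow> (\<forall>n. hits A A n (fst w) \<longrightarrow> t < arrival w n)"
    proof
      assume "waits A t w" then show "\<forall>n. hits A A n (fst w) \<longrightarrow> t < arrival w n"
        by (auto simp: waits_def hits_def)
    next
      assume *: "\<forall>n. hits A A n (fst w) \<longrightarrow> t < arrival w n"
      show "waits A t w"
        unfolding waits_def
      proof (intro allI impI)
        fix m assume "fst w m \<in> A"
        then obtain n where "n \<le> m" "hits A A n (fst w)" by (rule hits_exists)
        then show "t < arrival w m"
          using * arrival_mono[OF nn] by (meson less_le_trans)
      qed
    qed
    then show "w \<in> {w \<in> space (strip M). waits A t w} \<longleftrightarrow> w \<in> space (strip M) - (\<Union>n. H n)"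
      using w by (auto simp: H_def not_le)
  qed
  then have "measure (strip M) {w \<in> space (strip M). waits A t w} = measure (strip M) (space (strip M) - (\<Union>n. H n))"
    by (intro measure_eq_AE) measurable
  also have "\<dots> = exp (- prob A * t)"
    using U by (subst S.prob_compl) auto
  finally show ?thesis .
qed

text \<open>The strips are independent, so the survival probabilities multiply and the rates add up.
  Leaving out \<open>k\<close> amounts to giving that strip rate zero.\<close>

lemma prob_all_waits:
  assumes [measurable]: "\<And>j. B j \<in> events" and b: "(\<lambda>j. prob (B j)) sums b" and t: "0 \<le> t"
  shows "measure (strips M) {X \<in> space (strips M). \<forall>j. j \<noteq> k \<longrightarrow> waits (B j) t (X j)}
      = exp (- (b - prob (B k)) * t)"
proof -
  interpret T: prob_space "strip M" by (rule prob_space_strip)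
  interpret S: sequence_space "strip M" by unfold_locales
  define E where "E j = {w \<in> space (strip M). j \<noteq> k \<longrightarrow> waits (B j) t w}" for j
  have [measurable]: "E j \<in> sets (strip M)" for j
    unfolding E_def by measurable
  have eq: "{X \<in> space (strips M). \<forall>j. j \<noteq> k \<longrightarrow> waits (B j) t (X j)} = Pi UNIV E"
    by (auto simp: E_def space_PiM PiE_iff Pi_iff)
  define q where "q j = (if j = k then 0 else prob (B j))" for j
  have mE: "measure (strip M) (E j) = exp (- q j * t)" for j
  proof (cases "j = k")
    case True
    then have "E j = space (strip M)" by (auto simp: E_def)
    then show ?thesis using True by (simp add: q_def T.prob_space)
  next
    case False
    then show ?thesis using prob_waits[of "B j" t] t by (simp add: q_def E_def)
  qed
  have "(\<lambda>j. prob (B j) - (if j = k then prob (B j) else 0)) sums (b - prob (B k))"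
    by (intro sums_diff b sums_single)
  moreover have "(\<lambda>j. prob (B j) - (if j = k then prob (B j) else 0)) = q"
    by (auto simp: q_def)
  ultimately have q: "q sums (b - prob (B k))" by simp
  have "(\<lambda>n. \<Prod>i\<le>n. measure (strip M) (E i)) \<longlonglongrightarrow> measure (strips M) (Pi UNIV E)"
    by (rule S.measure_PiM_countable) measurable
  also have "(\<lambda>n. \<Prod>i\<le>n. measure (strip M) (E i)) = (\<lambda>n. exp (- (\<Sum>i\<le>n. q i) * t))"
    by (simp add: mE exp_sum[symmetric] sum_negf sum_distrib_right)
  finally have "(\<lambda>n. exp (- (\<Sum>i\<le>n. q i) * t)) \<longlonglongrightarrow> measure (strips M) (Pi UNIV E)" .
  moreover have "(\<lambda>n. exp (- (\<Sum>i\<le>n. q i) * t)) \<longlonglongrightarrow> exp (- (b - prob (B k)) * t)"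
    using q unfolding sums_def_le by (intro tendsto_intros)
  ultimately show ?thesis
    unfolding eq by (rule LIMSEQ_unique)
qed

end

text \<open>Point \<open>n\<close> of strip \<open>k\<close> is the earliest point, over all strips, whose mark lies in the
  target set of its strip. Within strip \<open>k\<close> the order of the indices replaces that of the arrival
  times, so that uniqueness needs no almost-sure positivity of the gaps.\<close>

definition winner :: "(nat \<Rightarrow> 'b set) \<Rightarrow> nat \<Rightarrow> nat \<Rightarrow> (nat \<Rightarrow> 'b marked) \<Rightarrow> bool" where
  "winner B k n \<omega> \<longleftrightarrow> hits (B k) (B k) n (fst (\<omega> k)) \<and>
     (\<forall>j. j \<noteq> k \<longrightarrow> waits (B j) (arrival (\<omega> k) n) (\<omega> j))"

text \<open>Winners in two different strips would each have to arrive strictly before the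
  other.\<close>

lemma winner_unique:
  assumes "winner B k n \<omega>" "winner B k' n' \<omega>"
  shows "k = k' \<and> n = n'"
proof (cases "k = k'")
  case True
  then show ?thesis using assms hits_unique[of "B k" "B k" n "fst (\<omega> k)" n'] by (simp add: winner_def)
next
  case False
  then have "arrival (\<omega> k) n < arrival (\<omega> k') n'" "arrival (\<omega> k') n' < arrival (\<omega> k) n"
    using assms by (auto simp: winner_def waits_def hits_def)
  then show ?thesis by simp
qed

text \<open>Shrinking the targets only removes competitors. This makes two samples agree: the region
  under each density is a smaller target inside the region under their maximum.\<close>

lemma winner_antimono:
  assumes "winner B k n \<omega>" "fst (\<omega> k) n \<in> C k" "\<And>j. C j \<subseteq> B j"
  shows "winner C k n \<omega>"
  using assms unfolding winner_def waits_def hits_def by blast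

lemma pred_winner [measurable]:
  assumes [measurable]: "\<And>j. B j \<in> sets L"
  shows "Measurable.pred (strips L) (winner B k n)"
  unfolding winner_def[abs_def] by measurable

section \<open>Winning probabilities of a race\<close>

context prob_space
begin

text \<open>The first \<open>n\<close> marks of strip \<open>k\<close> miss \<open>B k\<close> and
  the next lies in \<open>C\<close>. Given the arrival time \<open>t\<close> of that point, the
  other strips, of total rate \<open>c = b - prob (B k)\<close>, are silent with probability
  \<open>exp (- c * t)\<close>, whose mean is the last factor.\<close>

lemma prob_winner_at:
  assumes [measurable]: "\<And>j. B j \<in> events" "C \<in> events"
    and b: "(\<lambda>j. prob (B j)) sums b" and C: "C \<subseteq> B k"
  shows "measure (strips M) {\<omega> \<in> space (strips M). winner B k n \<omega> \<and> fst (\<omega> k) n \<in> C}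
      = (1 - prob (B k)) ^ n * prob C * (1 / (1 + (b - prob (B k)))) ^ Suc n"
proof -
  interpret S: prob_space "strip M" by (rule prob_space_strip)
  interpret R: prob_space "strips M" by (rule prob_space_strips)
  interpret G: prob_space gaps by (rule prob_space_gaps)
  interpret Y: prob_space "marks M" by (rule prob_space_marks)
  define c where "c = b - prob (B k)"
  have c: "0 \<le> c"
    using sum_le_suminf[of "\<lambda>j. prob (B j)" "{k}"] b by (simp add: c_def sums_iff)
  let ?W = "{\<omega> \<in> space (strips M). winner B k n \<omega> \<and> fst (\<omega> k) n \<in> C}"
  let ?V = "{p \<in> space (strip M \<Otimes>\<^sub>M strips M). hits (B k) C n (fst (fst p)) \<and>
      (\<forall>j. j \<noteq> k \<longrightarrow> waits (B j) (arrival (fst p) n) (snd p j))}"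
  have eq: "winner B k n \<omega> \<and> fst (\<omega> k) n \<in> C \<longleftrightarrow> hits (B k) C n (fst (\<omega> k)) \<and>
     (\<forall>j. j \<noteq> k \<longrightarrow> waits (B j) (arrival (\<omega> k) n) (\<omega> j))" for \<omega>
    using C by (auto simp: winner_def hits_def)
  \<comment> \<open>Resampling strip \<open>k\<close> independently preserves the law and separates it from the others.\<close>
  have upd: "(\<lambda>(x, X). X(k := x)) \<in> strip M \<Otimes>\<^sub>M strips M \<rightarrow>\<^sub>M strips M"
  proof (rule measurable_PiM_single')
    show "(\<lambda>p. (case p of (x, X) \<Rightarrow> X(k := x)) i) \<in> strip M \<Otimes>\<^sub>M strips M \<rightarrow>\<^sub>M strip M" for i
      by (cases "i = k") (simp_all add: case_prod_beta)
  qed (auto simp: space_pair_measure space_PiM PiE_iff)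
  have "distr (strip M \<Otimes>\<^sub>M strips M) (PiM (insert k UNIV) (\<lambda>_. strip M)) (\<lambda>(x, X). X(k := x))
      = PiM (insert k UNIV) (\<lambda>_. strip M)"
    by (rule distr_pair_PiM_eq_PiM) (rule prob_space_strip)+
  then have "emeasure (strips M) ?W
      = emeasure (distr (strip M \<Otimes>\<^sub>M strips M) (strips M) (\<lambda>(x, X). X(k := x))) ?W"
    by simp
  also have "\<dots> = emeasure (strip M \<Otimes>\<^sub>M strips M) ?V"
    using upd measurable_space[OF upd]
    by (subst emeasure_distr) (auto intro!: arg_cong2[where f = emeasure] simp: eq)
  also have "\<dots> = (\<integral>\<^sup>+x. emeasure (strips M) (Pair x -` ?V) \<partial>strip M)"
    by (rule R.emeasure_pair_measure_alt) measurable
  also have "\<dots> = (\<integral>\<^sup>+x. indicator {y \<in> space (marks M). hits (B k) C n y} (fst x) *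
      ennreal (exp (- c * (\<Sum>m\<le>n. snd x m))) \<partial>strip M)"
  \<comment> \<open>The exponential formula for silence asks for a nonnegative arrival time, which
    holds almost surely.\<close>
  proof (rule nn_integral_cong_AE)
    from AE_strip_nonneg show "AE x in strip M. emeasure (strips M) (Pair x -` ?V) =
        indicator {y \<in> space (marks M). hits (B k) C n y} (fst x) *
        ennreal (exp (- c * (\<Sum>m\<le>n. snd x m)))"
    proof (rule AE_mp, intro AE_I2 impI)
      fix x assume x: "x \<in> space (strip M)" and nn: "\<forall>n. 0 \<le> snd x n"
      have "0 \<le> arrival x n" using nn by (auto simp: arrival_def intro: sum_nonneg)
      then have *: "measure (strips M) {X \<in> space (strips M). \<forall>j. j \<noteq> k \<longrightarrow> waits (B j) (arrival x n) (X j)}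
          = exp (- c * arrival x n)"
        unfolding c_def by (intro prob_all_waits b) auto
      have "Pair x -` ?V = (if hits (B k) C n (fst x)
          then {X \<in> space (strips M). \<forall>j. j \<noteq> k \<longrightarrow> waits (B j) (arrival x n) (X j)} else {})"
        using x by (auto simp: space_pair_measure)
      then show "emeasure (strips M) (Pair x -` ?V) =
          indicator {y \<in> space (marks M). hits (B k) C n y} (fst x) *
          ennreal (exp (- c * (\<Sum>m\<le>n. snd x m)))"
        using x * by (auto simp: space_pair_measure R.emeasure_eq_measure arrival_def)
    qed
  qed
  also have "\<dots> = (\<integral>\<^sup>+y. \<integral>\<^sup>+s. indicator {y \<in> space (marks M). hits (B k) C n y} y *
      ennreal (exp (- c * (\<Sum>m\<le>n. s m))) \<partial>gaps \<partial>marks M)"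
    by (subst G.nn_integral_fst[symmetric]) (simp_all, measurable)
  also have "\<dots> = emeasure (marks M) {y \<in> space (marks M). hits (B k) C n y} *
      ennreal ((1 / (1 + c)) ^ Suc n)"
    by (simp add: nn_integral_cmult nn_integral_multc nn_integral_exp_arrival[OF c, simplified])
  also have "\<dots> = ennreal ((1 - prob (B k)) ^ n * prob C * (1 / (1 + c)) ^ Suc n)"
    using c by (subst Y.emeasure_eq_measure) (simp add: prob_hits ennreal_mult del: power_Suc)
  finally show ?thesis
    using c by (simp add: R.emeasure_eq_measure c_def[symmetric] del: power_Suc)
qed

text \<open>Competing exponential clocks win in proportion to their rates. For fixed
  \<open>k\<close> the sum over \<open>n\<close> is geometric, then the strips are summed;
  \<open>winner_unique\<close> makes all these events disjoint.\<close>

lemma prob_winner: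
  assumes [measurable]: "\<And>j. B j \<in> events" "\<And>j. C j \<in> events"
    and b: "(\<lambda>j. prob (B j)) sums b" "0 < b" and C: "\<And>j. C j \<subseteq> B j"
    and a: "(\<lambda>j. prob (C j)) sums a"
  shows "measure (strips M) {\<omega> \<in> space (strips M). \<exists>k n. winner B k n \<omega> \<and> fst (\<omega> k) n \<in> C k} = a / b"
proof -
  interpret R: prob_space "strips M" by (rule prob_space_strips)
  define W where "W k n = {\<omega> \<in> space (strips M). winner B k n \<omega> \<and> fst (\<omega> k) n \<in> C k}" for k n
  have [measurable]: "W k n \<in> sets (strips M)" for k n
    unfolding W_def by measurable
  have disj1: "disjoint_family (W k)" for k
    by (auto simp: disjoint_family_on_def W_def dest: winner_unique)
  have disj2: "disjoint_family (\<lambda>k. \<Union>n. W k n)"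
    by (auto simp: disjoint_family_on_def W_def dest: winner_unique)
  have m: "measure (strips M) (\<Union>n. W k n) = prob (C k) / b" for k
  proof -
    have "(\<lambda>n. measure (strips M) (W k n)) sums measure (strips M) (\<Union>n. W k n)"
      by (rule R.finite_measure_UNION) (use disj1 in auto)
    moreover have "(\<lambda>n. measure (strips M) (W k n)) sums (prob (C k) / b)"
    proof -
      define p where "p = prob (B k)"
      have p: "0 \<le> p" "p \<le> 1" "p \<le> b"
        using sum_le_suminf[of "\<lambda>j. prob (B j)" "{k}"] b by (auto simp: p_def sums_iff)
      define r where "r = 1 / (1 + (b - p))"
      \<comment> \<open>The ratio \<open>(1 - p) * r\<close> is below \<open>1\<close> because
        \<open>b\<close> is positive; the last identity cancels \<open>r\<close> from the sum,
        leaving only \<open>b\<close>.\<close>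
      have r: "0 < r" "\<bar>(1 - p) * r\<bar> < 1" "r * b = 1 - (1 - p) * r"
        using p b(2) by (auto simp: r_def field_simps)
      have "(\<lambda>n. prob (C k) * r * ((1 - p) * r) ^ n) sums (prob (C k) * r * (1 / (1 - (1 - p) * r)))"
        by (intro sums_mult geometric_sums) (use r in simp)
      also have "prob (C k) * r * (1 / (1 - (1 - p) * r)) = prob (C k) / b"
        using r(1) b(2) by (simp add: r(3)[symmetric])
      also have "(\<lambda>n. prob (C k) * r * ((1 - p) * r) ^ n) = (\<lambda>n. measure (strips M) (W k n))"
        unfolding W_def by (subst prob_winner_at[OF _ _ b(1) C]) 
          (auto simp: p_def r_def power_mult_distrib power_divide mult_ac)
      finally show ?thesis .
    qed
    ultimately show ?thesis by (rule sums_unique2)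
  qed
  have "(\<lambda>k. measure (strips M) (\<Union>n. W k n)) sums measure (strips M) (\<Union>k. \<Union>n. W k n)"
    by (rule R.finite_measure_UNION) (use disj2 in auto)
  moreover have "(\<lambda>k. measure (strips M) (\<Union>n. W k n)) sums (a / b)"
    unfolding m using a by (rule sums_divide)
  ultimately have "measure (strips M) (\<Union>k. \<Union>n. W k n) = a / b"
    by (rule sums_unique2)
  also have "(\<Union>k. \<Union>n. W k n) = {\<omega> \<in> space (strips M). \<exists>k n. winner B k n \<omega> \<and> fst (\<omega> k) n \<in> C k}"
    by (auto simp: W_def)
  finally show ?thesis .
qed

end

section \<open>Pairs of independent coordinates\<close>

lemma distr_PiM_pair:
  assumes "\<And>i. i \<in> I \<Longrightarrow> prob_space (M i)" and ij: "i \<in> I" "j \<in> I" "i \<noteq> j"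
  shows "distr (PiM I M) (M i \<Otimes>\<^sub>M M j) (\<lambda>\<omega>. (\<omega> i, \<omega> j)) = M i \<Otimes>\<^sub>M M j"
proof (rule pair_measure_eqI[symmetric])
  interpret i: prob_space "M i" by (rule assms(1)) fact
  interpret j: prob_space "M j" by (rule assms(1)) fact
  show "sigma_finite_measure (M i)" "sigma_finite_measure (M j)" by unfold_locales
  have [measurable]: "(\<lambda>\<omega>. \<omega> i) \<in> PiM I M \<rightarrow>\<^sub>M M i" "(\<lambda>\<omega>. \<omega> j) \<in> PiM I M \<rightarrow>\<^sub>M M j"
    using ij by simp_all
  fix A B assume AB[measurable]: "A \<in> sets (M i)" "B \<in> sets (M j)"
  let ?E = "\<lambda>l. if l = i then A else B"
  have "emeasure (distr (PiM I M) (M i \<Otimes>\<^sub>M M j) (\<lambda>\<omega>. (\<omega> i, \<omega> j))) (A \<times> B)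
      = emeasure (PiM I M) (prod_emb I M {i, j} (Pi\<^sub>E {i, j} ?E))"
    using ij by (subst emeasure_distr)
      (auto intro!: arg_cong2[where f = emeasure] simp: prod_emb_def space_PiM PiE_iff)
  also have "\<dots> = (\<Prod>l\<in>{i, j}. emeasure (M l) (?E l))"
    using ij AB by (intro emeasure_PiM_emb assms(1)) auto
  finally show "emeasure (M i) A * emeasure (M j) B =
      emeasure (distr (PiM I M) (M i \<Otimes>\<^sub>M M j) (\<lambda>\<omega>. (\<omega> i, \<omega> j))) (A \<times> B)"
    using ij by simp
qed simp

text \<open>Distinct coordinates are independent, so a relation that holds almost surely for
  independent points holds for them. Used for two strips and for two marks of one strip.\<close>

lemma AE_PiM_pair:
  assumes "\<And>i. i \<in> I \<Longrightarrow> prob_space (M i)" and ij: "i \<in> I" "j \<in> I" "i \<noteq> j"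
    and P: "AE p in M i \<Otimes>\<^sub>M M j. P (fst p) (snd p)"
  shows "AE \<omega> in PiM I M. P (\<omega> i) (\<omega> j)"
  using ij P by (subst (asm) distr_PiM_pair[OF assms(1-4), symmetric])
    (auto dest!: AE_distrD[rotated] intro!: measurable_Pair)

text \<open>Images of an independent pair are again independent; used to read positions off marks
  and strips.\<close>

lemma AE_pair_distr:
  assumes [measurable]: "f \<in> N \<rightarrow>\<^sub>M M" "g \<in> N' \<rightarrow>\<^sub>M M'"
    and d: "distr N M f = M" "distr N' M' g = M'" and "sigma_finite_measure M'"
    and P: "AE p in M \<Otimes>\<^sub>M M'. P (fst p) (snd p)"
  shows "AE q in N \<Otimes>\<^sub>M N'. P (f (fst q)) (g (snd q))"
proof -
  have eq: "distr (N \<Otimes>\<^sub>M N') (M \<Otimes>\<^sub>M M') (\<lambda>(x, y). (f x, g y)) = M \<Otimes>\<^sub>M M'"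
    using pair_measure_distr[of f N M g N' M'] assms by simp
  have "AE p in distr (N \<Otimes>\<^sub>M N') (M \<Otimes>\<^sub>M M') (\<lambda>(x, y). (f x, g y)). P (fst p) (snd p)"
    unfolding eq by (rule P)
  then have "AE q in N \<Otimes>\<^sub>M N'. P (fst (case q of (x, y) \<Rightarrow> (f x, g y))) (snd (case q of (x, y) \<Rightarrow> (f x, g y)))"
    by (rule AE_distrD[rotated]) measurable
  then show ?thesis by (simp add: case_prod_beta)
qed

section \<open>Resolving a probability space by countably many events\<close>

definition twins :: "(nat \<Rightarrow> 'a set) \<Rightarrow> 'a \<Rightarrow> 'a \<Rightarrow> bool" where
  "twins D x y \<longleftrightarrow> (\<forall>n. x \<in> D n \<longleftrightarrow> y \<in> D n)"

lemma twins_refl: "twins D x x"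
  by (simp add: twins_def)

lemma pred_twins [measurable (raw)]:
  assumes "range D \<subseteq> sets M" and [measurable]: "f \<in> N \<rightarrow>\<^sub>M M" "g \<in> N \<rightarrow>\<^sub>M M"
  shows "Measurable.pred N (\<lambda>x. twins D (f x) (g x))"
proof -
  have [measurable]: "D n \<in> sets M" for n using assms(1) by auto
  show ?thesis unfolding twins_def by measurable
qed

text \<open>A countable family of events that decides membership in any given event simultaneously for two
  independent points, unless the family already tells the points apart. Diagonals need not be
  measurable, but the twin relation of such a family is, and identifying twins changes no law.\<close>

definition resolves :: "'a measure \<Rightarrow> (nat \<Rightarrow> 'a set) \<Rightarrow> bool" where
  "resolves M D \<longleftrightarrow> range D \<subseteq> sets M \<and>
     (\<forall>A\<in>sets M. AE p in M \<Otimes>\<^sub>M M. twins D (fst p) (snd p) \<longrightarrow> (fst p \<in> A \<longleftrightarrow> snd p \<in> A))"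

text \<open>Take a family whose twin relation has the least probability: adding one more event to it
  separates almost no further pair.\<close>

lemma (in prob_space) resolves_exists: "\<exists>D. resolves M D"
proof -
  interpret MM: prob_space "M \<Otimes>\<^sub>M M" by (intro prob_space_pair) unfold_locales
  define S where "S D = {p \<in> space (M \<Otimes>\<^sub>M M). twins D (fst p) (snd p)}" for D
  define q where "q D = measure (M \<Otimes>\<^sub>M M) (S D)" for D
  define \<D> where "\<D> = {D :: nat \<Rightarrow> 'a set. range D \<subseteq> events}"
  have S [measurable]: "S D \<in> sets (M \<Otimes>\<^sub>M M)" if "D \<in> \<D>" for D
  proof -
    have [measurable]: "Measurable.pred (M \<Otimes>\<^sub>M M) (\<lambda>p. twins D (fst p) (snd p))"
      by (rule pred_twins[of D M]) (use that in \<open>simp_all add: \<D>_def\<close>)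
    show ?thesis unfolding S_def by measurable
  qed
  \<comment> \<open>A larger family of events separates more pairs.\<close>
  have q_mono: "q D \<le> q D'" if "range D' \<subseteq> range D" "D' \<in> \<D>" for D D'
  proof -
    have "S D \<subseteq> S D'"
      using that(1) unfolding S_def twins_def by (auto simp: subset_iff image_iff) metis+
    then show ?thesis
      unfolding q_def by (intro MM.finite_measure_mono S that)
  qed
  define i where "i = Inf (q ` \<D>)"
  have i_le: "i \<le> q D" if "D \<in> \<D>" for D
    unfolding i_def using that by (intro cInf_lower) (auto intro!: bdd_belowI[of _ 0] simp: q_def)
  have "\<exists>D\<in>\<D>. q D < i + 1 / real (Suc n)" for n
  proof -
    have "(\<lambda>_. {}) \<in> \<D>" by (auto simp: \<D>_def)
    then have "q ` \<D> \<noteq> {}" by auto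
    from cInf_lessD[OF this, of "i + 1 / real (Suc n)"] show ?thesis
      by (auto simp: i_def)
  qed
  then obtain F where F: "\<And>n. F n \<in> \<D>" "\<And>n. q (F n) < i + 1 / real (Suc n)"
    by metis
  \<comment> \<open>The near-minimisers \<open>F n\<close> are merged into one sequence by the
    pairing of naturals; containing each of them, it attains the infimum.\<close>
  define D where "D k = F (fst (prod_decode k)) (snd (prod_decode k))" for k
  have D: "D \<in> \<D>"
    using F(1) by (auto simp: D_def \<D>_def)
  have "q D \<le> i"
  proof (rule field_le_epsilon)
    fix e :: real assume "0 < e"
    then obtain n where "1 / real (Suc n) < e"
      using nat_approx_posE by metis
    moreover have "range (F n) \<subseteq> range D"
    proof
      fix A assume "A \<in> range (F n)"
      then obtain m where "A = F n m" by auto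
      then have "A = D (prod_encode (n, m))" by (simp add: D_def)
      then show "A \<in> range D" by simp
    qed
    then have "q D \<le> q (F n)" by (intro q_mono F)
    ultimately show "q D \<le> i + e"
      using F(2)[of n] by simp
  qed
  have "AE p in M \<Otimes>\<^sub>M M. twins D (fst p) (snd p) \<longrightarrow> (fst p \<in> A \<longleftrightarrow> snd p \<in> A)"
    if A: "A \<in> events" for A
  proof -
    \<comment> \<open>Adjoining \<open>A\<close> cannot lower the minimal probability, so the pairs
      that only \<open>A\<close> separates form a null set.\<close>
    define D' where "D' = case_nat A D"
    have D': "D' \<in> \<D>"
      using A D by (auto simp: D'_def \<D>_def split: nat.split)
    have sub: "S D' \<subseteq> S D"
    proof -
      have "twins D x y" if "twins D' x y" for x y
        unfolding twins_def
      proof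
        fix n show "(x \<in> D n) = (y \<in> D n)"
          using that[unfolded twins_def, rule_format, of "Suc n"] by (simp add: D'_def)
      qed
      then show ?thesis by (auto simp: S_def)
    qed
    have "q D - q D' \<le> 0"
      using \<open>q D \<le> i\<close> i_le[OF D'] by simp
    moreover have "measure (M \<Otimes>\<^sub>M M) (S D - S D') = q D - q D'"
      unfolding q_def by (intro MM.finite_measure_Diff S D D' sub)
    ultimately have "measure (M \<Otimes>\<^sub>M M) (S D - S D') = 0"
      using measure_nonneg[of "M \<Otimes>\<^sub>M M" "S D - S D'"] by linarith
    then have "AE p in M \<Otimes>\<^sub>M M. p \<notin> S D - S D'"
      using S[OF D] S[OF D'] by (intro AE_not_in) (auto simp: null_sets_def MM.emeasure_eq_measure)
    then show ?thesis
    proof (rule AE_mp, intro AE_I2 impI)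
      fix p assume p: "p \<in> space (M \<Otimes>\<^sub>M M)" "p \<notin> S D - S D'" "twins D (fst p) (snd p)"
      then have "twins D' (fst p) (snd p)" by (auto simp: S_def)
      from this[unfolded twins_def, rule_format, of 0] show "(fst p \<in> A) = (snd p \<in> A)"
        by (simp add: D'_def)
    qed
  qed
  with D show ?thesis
    unfolding resolves_def \<D>_def by blast
qed

section \<open>The region under a density\<close>

definition unit_law :: "real measure" where
  "unit_law = uniform_measure lborel {0..<1}"

lemma sets_unit_law [measurable_cong, simp]: "sets unit_law = sets borel"
  by (simp add: unit_law_def)

lemma space_unit_law [simp]: "space unit_law = UNIV"
  by (simp add: unit_law_def)

lemma prob_space_unit_law: "prob_space unit_law"
  unfolding unit_law_def by (rule prob_space_uniform_measure) auto

lemma emeasure_unit_law: "A \<in> sets borel \<Longrightarrow> emeasure unit_law A = emeasure lborel ({0..<1} \<inter> A)"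
  by (simp add: unit_law_def divide_ennreal_def)

text \<open>Copies of the unit interval, the \<open>k\<close>-th shifted up by \<open>k\<close>,
  tile the half-line, so the sum is the length of the part below \<open>a\<close>. An infinite
  \<open>a\<close> fills every copy.\<close>

lemma suminf_unit_strips:
  "(\<Sum>k. emeasure unit_law {u. ennreal (real k + u) < a}) = a"
proof (cases a rule: ennreal_cases)
  case (real r)
  define A where "A k = {v. real k \<le> v \<and> v < real k + 1 \<and> v < r}" for k
  have "emeasure unit_law {u. ennreal (real k + u) < a} = emeasure lborel (A k)" for k
  proof -
    have [measurable]: "{u. ennreal (real k + u) < a} \<in> sets lborel" by measurable
    have [measurable]: "A k \<in> sets borel" unfolding A_def by measurable
    have "emeasure unit_law {u. ennreal (real k + u) < a}
        = emeasure lborel ({0..<1} \<inter> {u. ennreal (real k + u) < a})"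
      by (rule emeasure_unit_law) measurable
    also have "{0..<1} \<inter> {u. ennreal (real k + u) < a} = (+) (real k) -` A k"
      using real by (auto simp: A_def ennreal_less_iff simp del: ennreal_plus)
    also have "emeasure lborel ((+) (real k) -` A k) = emeasure (distr lborel borel ((+) (real k))) (A k)"
      by (subst emeasure_distr) auto
    finally show ?thesis by (simp add: lborel_distr_plus)
  qed
  then have "(\<Sum>k. emeasure unit_law {u. ennreal (real k + u) < a}) = (\<Sum>k. emeasure lborel (A k))"
    by simp
  also have "\<dots> = emeasure lborel (\<Union>k. A k)"
  proof (rule suminf_emeasure)
    show "range A \<subseteq> sets lborel" unfolding A_def by auto
    show "disjoint_family A"
      unfolding disjoint_family_on_def
    proof (intro ballI impI)
      fix k l :: nat assume "k \<noteq> l"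
      then have "real k + 1 \<le> real l \<or> real l + 1 \<le> real k" by linarith
      then show "A k \<inter> A l = {}" by (auto simp: A_def)
    qed
  qed
  also have "(\<Union>k. A k) = {0..<r}"
  proof
    show "{0..<r} \<subseteq> (\<Union>k. A k)"
    proof
      fix v assume "v \<in> {0..<r}"
      then have "v \<in> A (nat \<lfloor>v\<rfloor>)" by (auto simp: A_def)
      then show "v \<in> (\<Union>k. A k)" by blast
    qed
  qed (auto simp: A_def)
  finally show ?thesis using real by simp
next
  case top
  have "(\<Sum>k::nat. 1 :: ennreal) = (\<integral>\<^sup>+k. 1 \<partial>count_space (UNIV :: nat set))"
    by (simp only: nn_integral_count_space_nat)
  also have "\<dots> = top" by simp
  finally show ?thesis
    using top prob_space.emeasure_space_1[OF prob_space_unit_law] by simp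
qed

abbreviation area_law :: "'a measure \<Rightarrow> ('a \<times> real) measure" where
  "area_law M \<equiv> M \<Otimes>\<^sub>M unit_law"

text \<open>Cuts the region under the graph of \<open>f\<close> into strips of height one, each shifted down to start
  at height \<open>0\<close>. The lower bound \<open>0 \<le> snd p\<close> is left to \<^const>\<open>unit_law\<close>.\<close>

definition slice :: "'a measure \<Rightarrow> ('a \<Rightarrow> ennreal) \<Rightarrow> nat \<Rightarrow> ('a \<times> real) set" where
  "slice M f k = {p \<in> space M \<times> UNIV. ennreal (real k + snd p) < f (fst p)}"

lemma sets_slice [measurable]:
  assumes [measurable]: "f \<in> borel_measurable M"
  shows "slice M f k \<in> sets (area_law M)"
proof -
  have "slice M f k = {p \<in> space (area_law M). ennreal (real k + snd p) < f (fst p)}"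
    by (simp add: slice_def space_pair_measure)
  also have "\<dots> \<in> sets (area_law M)" by measurable
  finally show ?thesis .
qed

lemma slice_mono: "(\<And>x. f x \<le> g x) \<Longrightarrow> slice M f k \<subseteq> slice M g k"
  by (auto simp: slice_def intro: less_le_trans)

text \<open>By Fubini the total rate of the slices is the area under the graph; here a density
  becomes the rate of a race.\<close>

lemma suminf_slice:
  assumes [measurable]: "f \<in> borel_measurable M"
  shows "(\<Sum>k. emeasure (area_law M) (slice M f k)) = (\<integral>\<^sup>+x. f x \<partial>M)"
proof -
  interpret U: prob_space unit_law by (rule prob_space_unit_law)
  have "emeasure (area_law M) (slice M f k) =
      (\<integral>\<^sup>+x. emeasure unit_law {u. ennreal (real k + u) < f x} \<partial>M)" for k
    by (subst U.emeasure_pair_measure_alt)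
      (auto intro!: nn_integral_cong arg_cong2[where f = emeasure] simp: slice_def)
  moreover have "(\<lambda>x. emeasure unit_law {u. ennreal (real k + u) < f x}) \<in> borel_measurable M" for k
    by measurable
  ultimately show ?thesis
    by (simp add: nn_integral_suminf[symmetric] suminf_unit_strips)
qed

lemma sums_slice:
  assumes [measurable]: "f \<in> borel_measurable M" and "prob_space M"
    and "(\<integral>\<^sup>+x. f x \<partial>M) = ennreal b" "0 \<le> b"
  shows "(\<lambda>k. measure (area_law M) (slice M f k)) sums b"
proof -
  interpret prob_space "area_law M"
    by (intro prob_space_pair prob_space_unit_law assms)
  have "(\<Sum>k. ennreal (measure (area_law M) (slice M f k))) = ennreal b"
    unfolding emeasure_eq_measure[symmetric] suminf_slice[OF assms(1)] by (rule assms)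
  then have "(\<lambda>k. ennreal (measure (area_law M) (slice M f k))) sums ennreal b"
    using summable_sums[OF summableI, of "\<lambda>k. ennreal (measure (area_law M) (slice M f k))"] by simp
  then show ?thesis
    using assms(4) by (subst (asm) sums_ennreal) auto
qed

section \<open>Sampling by the first point under a density\<close>

text \<open>The points of all strips are enumerated by a single natural number coding strip and
  index, so that \<open>LEAST\<close> can select among them measurably.\<close>

definition mark :: "(nat \<Rightarrow> ('a \<times> real) marked) \<Rightarrow> nat \<Rightarrow> 'a" where
  "mark \<omega> e = fst (fst (\<omega> (fst (prod_decode e))) (snd (prod_decode e)))"

text \<open>A winner is unique if it exists; \<open>LEAST\<close> is a measurable way to name
  it.\<close>

definition pick :: "'a measure \<Rightarrow> ('a \<Rightarrow> ennreal) \<Rightarrow> (nat \<Rightarrow> ('a \<times> real) marked) \<Rightarrow> nat" where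
  "pick M f \<omega> = (LEAST e. winner (slice M f) (fst (prod_decode e)) (snd (prod_decode e)) \<omega>)"

text \<open>The position of the winner is replaced by the first twin in the enumeration of all points.
  Two samples then agree exactly if the winners are twins, which is a measurable event.\<close>

definition sample ::
    "'a measure \<Rightarrow> (nat \<Rightarrow> 'a set) \<Rightarrow> ('a \<Rightarrow> ennreal) \<Rightarrow> (nat \<Rightarrow> ('a \<times> real) marked) \<Rightarrow> 'a" where
  "sample M D f \<omega> = mark \<omega> (LEAST e. twins D (mark \<omega> e) (mark \<omega> (pick M f \<omega>)))"

lemma measurable_mark [measurable]: "(\<lambda>\<omega>. mark \<omega> e) \<in> strips (area_law M) \<rightarrow>\<^sub>M M"
  unfolding mark_def by measurable

lemma measurable_pick [measurable]:
  assumes [measurable]: "f \<in> borel_measurable M"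
  shows "pick M f \<in> strips (area_law M) \<rightarrow>\<^sub>M count_space UNIV"
  unfolding pick_def[abs_def] by measurable

lemma measurable_mark_at [measurable (raw)]:
  assumes "g \<in> strips (area_law M) \<rightarrow>\<^sub>M count_space UNIV"
  shows "(\<lambda>\<omega>. mark \<omega> (g \<omega>)) \<in> strips (area_law M) \<rightarrow>\<^sub>M M"
  by (rule measurable_compose_countable[OF measurable_mark assms])

lemma measurable_sample:
  assumes [measurable]: "f \<in> borel_measurable M" and "range D \<subseteq> sets M"
  shows "sample M D f \<in> strips (area_law M) \<rightarrow>\<^sub>M M"
proof -
  have [measurable]: "Measurable.pred (strips (area_law M)) (\<lambda>\<omega>. twins D (mark \<omega> e) (mark \<omega> (pick M f \<omega>)))" for e
    by (rule pred_twins[OF assms(2)]) measurable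
  show ?thesis unfolding sample_def[abs_def] by measurable
qed

lemma twins_sample: "twins D (sample M D f \<omega>) (mark \<omega> (pick M f \<omega>))"
  unfolding sample_def by (rule LeastI[where P = "\<lambda>e. twins D (mark \<omega> e) (mark \<omega> (pick M f \<omega>))"])
    (rule twins_refl)

text \<open>Twin winners have the same twins among the marks, hence the same first one; conversely
  each sample is a twin of its winner.\<close>

lemma sample_eq_iff:
  "sample M D f \<omega> = sample M D g \<omega> \<longleftrightarrow> twins D (mark \<omega> (pick M f \<omega>)) (mark \<omega> (pick M g \<omega>))"
proof
  assume "sample M D f \<omega> = sample M D g \<omega>"
  then show "twins D (mark \<omega> (pick M f \<omega>)) (mark \<omega> (pick M g \<omega>))"
    using twins_sample[of D M f \<omega>] twins_sample[of D M g \<omega>] by (simp add: twins_def)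
next
  assume "twins D (mark \<omega> (pick M f \<omega>)) (mark \<omega> (pick M g \<omega>))"
  then have "twins D (mark \<omega> e) (mark \<omega> (pick M f \<omega>)) \<longleftrightarrow> twins D (mark \<omega> e) (mark \<omega> (pick M g \<omega>))" for e
    by (simp add: twins_def)
  then show "sample M D f \<omega> = sample M D g \<omega>"
    by (simp add: sample_def)
qed

lemma pick_winner:
  assumes "winner (slice M f) k n \<omega>"
  shows "pick M f \<omega> = prod_encode (k, n)"
  unfolding pick_def
proof (rule Least_equality)
  fix e assume "winner (slice M f) (fst (prod_decode e)) (snd (prod_decode e)) \<omega>"
  from winner_unique[OF assms this] have "prod_decode e = (k, n)"
    by (simp add: prod_eq_iff)
  then have "e = prod_encode (k, n)"
    by (metis prod_decode_inverse)
  then show "prod_encode (k, n) \<le> e" by simp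
qed (use assms in simp)

section \<open>The law of a sample and the disagreement of two samples\<close>

context prob_space
begin

lemma prob_space_area_law: "prob_space (area_law M)"
  by (intro prob_space_pair prob_space_unit_law) unfold_locales

text \<open>There are countably many pairs of points, and the positions of two different points are
  independent with law \<open>M\<close>, in one strip or in two. So \<open>resolves\<close> applies
  to each pair.\<close>

lemma AE_marks_resolved:
  assumes "resolves M D" and A: "A \<in> events"
  shows "AE \<omega> in strips (area_law M). \<forall>e e'. twins D (mark \<omega> e) (mark \<omega> e') \<longrightarrow> (mark \<omega> e \<in> A \<longleftrightarrow> mark \<omega> e' \<in> A)"
proof -
  interpret U: prob_space unit_law by (rule prob_space_unit_law)
  interpret L: prob_space "area_law M" by (rule prob_space_area_law)
  interpret G: prob_space gaps by (rule prob_space_gaps)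
  let ?L = "area_law M"
  define Q where "Q x y \<longleftrightarrow> (twins D x y \<longrightarrow> (x \<in> A \<longleftrightarrow> y \<in> A))" for x y
  have Q: "AE p in M \<Otimes>\<^sub>M M. Q (fst p) (snd p)"
    using assms by (simp add: resolves_def Q_def)
  have sf: "sigma_finite_measure M" by unfold_locales
  have dL: "distr ?L M fst = M" by (rule U.distr_pair_fst)
  have dS: "distr (strip ?L) (marks ?L) fst = marks ?L" by (rule G.distr_pair_fst)
  have dn: "distr (strip ?L) M (\<lambda>w. fst (fst w n)) = M" for n
  proof -
    have "distr (marks ?L) ?L (\<lambda>y. y n) = ?L"
      by (rule distr_PiM_component) (auto intro: L.prob_space_axioms)
    then have "M = distr (distr (distr (strip ?L) (marks ?L) fst) ?L (\<lambda>y. y n)) M fst"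
      by (simp add: dS dL)
    also have "\<dots> = distr (strip ?L) M (\<lambda>w. fst (fst w n))"
      by (simp add: distr_distr comp_def)
    finally show ?thesis by simp
  qed
  have "AE \<omega> in strips ?L. Q (fst (fst (\<omega> k) n)) (fst (fst (\<omega> j) m))" for k j n m
  proof (cases "k = j")
    case False
    have "AE p in strip ?L \<Otimes>\<^sub>M strip ?L. Q (fst (fst (fst p) n)) (fst (fst (snd p) m))"
      using AE_pair_distr[where P = Q, OF _ _ dn[of n] dn[of m] sf Q] by simp
    then show ?thesis
      using False by (intro AE_PiM_pair[where P = "\<lambda>w w'. Q (fst (fst w n)) (fst (fst w' m))"]
          L.prob_space_strip) auto
  next
    case [simp]: True
    show ?thesis
    proof (cases "n = m")
      case True
      then show ?thesis by (simp add: Q_def)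
    next
      case False
      have "AE p in ?L \<Otimes>\<^sub>M ?L. Q (fst (fst p)) (fst (snd p))"
        using AE_pair_distr[where P = Q, OF _ _ dL dL sf Q] by simp
      then have "AE y in marks ?L. Q (fst (y n)) (fst (y m))"
        using False by (intro AE_PiM_pair[where P = "\<lambda>y y'. Q (fst y) (fst y')"] L.prob_space_axioms) auto
      then have "AE y in distr (strip ?L) (marks ?L) fst. Q (fst (y n)) (fst (y m))"
        unfolding dS .
      then have "AE w in strip ?L. Q (fst (fst w n)) (fst (fst w m))"
        by (rule AE_distrD[rotated]) simp
      then show ?thesis
        by (simp, intro AE_PiM_component[where P = "\<lambda>w. Q (fst (fst w n)) (fst (fst w m))"]
            L.prob_space_strip) auto
    qed
  qed
  then have "AE \<omega> in strips ?L. \<forall>e e'. Q (mark \<omega> e) (mark \<omega> e')"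
    unfolding mark_def AE_all_countable by blast
  then show ?thesis by (simp add: Q_def)
qed

text \<open>The first point under the graph lies over \<open>A\<close> with probability the area
  over \<open>A\<close> divided by the total area \<open>1\<close>, and passing to a twin almost
  surely preserves membership in \<open>A\<close>. One inequality is enough: between probability
  measures, complements supply the other.\<close>

lemma distr_sample:
  assumes [measurable]: "f \<in> borel_measurable M" and D: "resolves M D"
    and f: "(\<integral>\<^sup>+x. f x \<partial>M) = 1"
  shows "distr (strips (area_law M)) M (sample M D f) = density M f"
proof -
  interpret L: prob_space "area_law M" by (rule prob_space_area_law)
  interpret R: prob_space "strips (area_law M)" by (rule L.prob_space_strips)
  have [measurable]: "sample M D f \<in> strips (area_law M) \<rightarrow>\<^sub>M M"
    using D by (intro measurable_sample) (auto simp: resolves_def)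
  interpret S: prob_space "distr (strips (area_law M)) M (sample M D f)"
    by (rule R.prob_space_distr) measurable
  interpret F: prob_space "density M f"
    by (rule prob_spaceI) (simp add: emeasure_density f cong: nn_integral_cong)
  have le: "measure (density M f) A \<le> measure (distr (strips (area_law M)) M (sample M D f)) A"
    if A [measurable]: "A \<in> events" for A
  proof -
    \<comment> \<open>The part of the region under \<open>f\<close> that lies over
      \<open>A\<close>.\<close>
    let ?C = "slice M (\<lambda>x. f x * indicator A x)"
    let ?W = "{\<omega> \<in> space (strips (area_law M)). \<exists>k n. winner (slice M f) k n \<omega> \<and> fst (\<omega> k) n \<in> ?C k}"
    have W: "measure (strips (area_law M)) ?W = measure (density M f) A / 1"
    proof (rule L.prob_winner)
      show "(\<lambda>j. L.prob (slice M f j)) sums 1"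
        by (rule sums_slice) (use f in \<open>auto intro: prob_space_axioms\<close>)
      show "(\<lambda>j. L.prob (?C j)) sums measure (density M f) A"
        by (rule sums_slice)
          (auto intro: prob_space_axioms simp: F.emeasure_eq_measure[symmetric] emeasure_density)
      show "?C j \<subseteq> slice M f j" for j
        by (rule slice_mono) (simp split: split_indicator)
      show "slice M f j \<in> L.events" "?C j \<in> L.events" for j
        by (rule sets_slice, measurable)+
    qed simp
    have "measure (strips (area_law M)) ?W
        \<le> measure (strips (area_law M)) (sample M D f -` A \<inter> space (strips (area_law M)))"
    proof (rule R.finite_measure_mono_AE)
      show "AE \<omega> in strips (area_law M). \<omega> \<in> ?W \<longrightarrow> \<omega> \<in> sample M D f -` A \<inter> space (strips (area_law M))"
        using AE_marks_resolved[OF D A]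
      proof (rule AE_mp, intro AE_I2 impI)
        fix \<omega> assume *: "\<forall>e e'. twins D (mark \<omega> e) (mark \<omega> e') \<longrightarrow> (mark \<omega> e \<in> A) = (mark \<omega> e' \<in> A)"
          and "\<omega> \<in> ?W"
        then obtain k n where \<omega>: "\<omega> \<in> space (strips (area_law M))"
          and "winner (slice M f) k n \<omega>" "fst (\<omega> k) n \<in> ?C k" by auto
        then have "pick M f \<omega> = prod_encode (k, n)" "fst (fst (\<omega> k) n) \<in> A"
          by (auto simp: pick_winner slice_def split: split_indicator_asm)
        then have "mark \<omega> (pick M f \<omega>) \<in> A" by (simp add: mark_def)
        moreover have "twins D (sample M D f \<omega>) (mark \<omega> (pick M f \<omega>))" by (rule twins_sample)
        ultimately have "sample M D f \<omega> \<in> A"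
          using * by (simp add: sample_def)
        with \<omega> show "\<omega> \<in> sample M D f -` A \<inter> space (strips (area_law M))" by simp
      qed
    qed measurable
    with W show ?thesis by (simp add: measure_distr)
  qed
  show ?thesis
  proof (rule measure_eqI)
    fix A assume "A \<in> sets (distr (strips (area_law M)) M (sample M D f))"
    then have A: "A \<in> events" by simp
    have "measure (density M f) A \<le> measure (distr (strips (area_law M)) M (sample M D f)) A"
      by (rule le) (rule A)
    moreover have "1 - measure (density M f) A \<le> 1 - measure (distr (strips (area_law M)) M (sample M D f)) A"
      using le[of "space M - A"] S.prob_compl[of A] F.prob_compl[of A] A by simp
    ultimately show "emeasure (distr (strips (area_law M)) M (sample M D f)) A = emeasure (density M f) A"
      by (simp add: S.emeasure_eq_measure F.emeasure_eq_measure)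
  qed simp
qed

lemma sets_sample_neq:
  assumes [measurable]: "f \<in> borel_measurable M" "g \<in> borel_measurable M" and D: "range D \<subseteq> events"
  shows "{\<omega> \<in> space (strips (area_law M)). sample M D f \<omega> \<noteq> sample M D g \<omega>} \<in> sets (strips (area_law M))"
proof -
  have [measurable]: "Measurable.pred (strips (area_law M))
      (\<lambda>\<omega>. twins D (mark \<omega> (pick M f \<omega>)) (mark \<omega> (pick M g \<omega>)))"
    by (rule pred_twins[OF D]) measurable
  show ?thesis unfolding sample_eq_iff by measurable
qed

lemma prob_sample_neq:
  assumes [measurable]: "f \<in> borel_measurable M" "g \<in> borel_measurable M" and D: "range D \<subseteq> events"
    and f: "(\<integral>\<^sup>+x. f x \<partial>M) = 1" and g: "(\<integral>\<^sup>+x. g x \<partial>M) = 1"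
    and c: "(\<integral>\<^sup>+x. max (f x) (g x) \<partial>M) = ennreal c" "0 \<le> c"
  shows "measure (strips (area_law M)) {\<omega> \<in> space (strips (area_law M)). sample M D f \<omega> \<noteq> sample M D g \<omega>}
      \<le> 2 - 2 / c"
proof -
  interpret L: prob_space "area_law M" by (rule prob_space_area_law)
  interpret R: prob_space "strips (area_law M)" by (rule L.prob_space_strips)
  let ?B = "slice M (\<lambda>x. max (f x) (g x))" and ?C = "slice M (\<lambda>x. min (f x) (g x))"
  let ?N = "{\<omega> \<in> space (strips (area_law M)). sample M D f \<omega> \<noteq> sample M D g \<omega>}"
  let ?W = "{\<omega> \<in> space (strips (area_law M)). \<exists>k n. winner ?B k n \<omega> \<and> fst (\<omega> k) n \<in> ?C k}"
  have "(\<integral>\<^sup>+x. f x \<partial>M) \<le> (\<integral>\<^sup>+x. max (f x) (g x) \<partial>M)"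
    by (intro nn_integral_mono) simp
  then have c1: "1 \<le> c" using f c by simp
  \<comment> \<open>Minimum and maximum add up to \<open>f + g\<close>, so the region under the
    minimum has area \<open>2 - c\<close>.\<close>
  have "(\<integral>\<^sup>+x. min (f x) (g x) \<partial>M) + (\<integral>\<^sup>+x. max (f x) (g x) \<partial>M) = (\<integral>\<^sup>+x. min (f x) (g x) + max (f x) (g x) \<partial>M)"
    by (rule nn_integral_add[symmetric]) measurable
  also have "\<dots> = (\<integral>\<^sup>+x. f x + g x \<partial>M)"
    by (intro nn_integral_cong) (simp add: min_def max_def add.commute)
  also have "\<dots> = ennreal 2"
    by (subst nn_integral_add) (simp_all add: f g)
  finally have sum: "(\<integral>\<^sup>+x. min (f x) (g x) \<partial>M) + ennreal c = ennreal 2"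
    by (simp add: c)
  then have "ennreal c \<le> ennreal 2"
    by (metis add_increasing order_refl zero_le)
  then have c2: "c \<le> 2" by (subst (asm) ennreal_le_iff) simp_all
  have min: "(\<integral>\<^sup>+x. min (f x) (g x) \<partial>M) = ennreal (2 - c)"
    using arg_cong[OF sum, of "\<lambda>x. x - ennreal c"] c ennreal_minus[of c 2] by simp
  have W: "measure (strips (area_law M)) ?W = (2 - c) / c"
  proof (rule L.prob_winner)
    show "(\<lambda>j. L.prob (?B j)) sums c"
      by (rule sums_slice) (use c in \<open>auto intro: prob_space_axioms\<close>)
    show "(\<lambda>j. L.prob (?C j)) sums (2 - c)"
      by (rule sums_slice) (use min c2 in \<open>auto intro: prob_space_axioms\<close>)
    show "?C j \<subseteq> ?B j" for j
      by (rule slice_mono) (auto simp: min_def max_def)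
    show "?B j \<in> L.events" "?C j \<in> L.events" for j
      by (rule sets_slice, measurable)+
  qed (use c1 in simp)
  have "?N \<subseteq> space (strips (area_law M)) - ?W"
  proof safe
    fix \<omega> k n assume neq: "sample M D f \<omega> \<noteq> sample M D g \<omega>"
      and w: "winner ?B k n \<omega>" "fst (\<omega> k) n \<in> ?C k"
    have "fst (\<omega> k) n \<in> slice M f k" "fst (\<omega> k) n \<in> slice M g k"
      using w(2) slice_mono[of "\<lambda>x. min (f x) (g x)" f M k] slice_mono[of "\<lambda>x. min (f x) (g x)" g M k] by auto
    \<comment> \<open>The winner for the larger region lies in both smaller ones, hence wins both
      races.\<close>
    then have "winner (slice M f) k n \<omega>" "winner (slice M g) k n \<omega>"
      using w(1) by (auto intro!: winner_antimono[where B = ?B] slice_mono)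
    then have "pick M f \<omega> = pick M g \<omega>" by (simp add: pick_winner)
    with neq show False by (simp add: sample_def)
  qed
  then have "measure (strips (area_law M)) ?N \<le> measure (strips (area_law M)) (space (strips (area_law M)) - ?W)"
    by (intro R.finite_measure_mono) measurable
  also have "\<dots> = 1 - (2 - c) / c"
    unfolding W[symmetric] by (rule R.prob_compl) measurable
  also have "\<dots> = 2 - 2 / c"
    using c1 by (simp add: field_simps)
  finally show ?thesis .
qed

end

section \<open>The coupling\<close>

text \<open>A strictly positive integrable function, normalised, is the required density. The
  probability measure \<open>N\<close> guarantees that \<open>M\<close> is not zero, so that the
  integral can be divided by.\<close>

lemma (in sigma_finite_measure) equivalent_prob_space:
  assumes "absolutely_continuous M N" "sets N = sets M" "prob_space N"
  shows "\<exists>\<nu>. prob_space \<nu> \<and> sets \<nu> = sets M \<and> null_sets \<nu> = null_sets M"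
proof -
  obtain h where h [measurable]: "h \<in> borel_measurable M" and fin: "(\<integral>\<^sup>+x. h x \<partial>M) \<noteq> \<infinity>"
    and pos: "\<And>x. x \<in> space M \<Longrightarrow> 0 < h x"
    using Ex_finite_integrable_function by auto
  interpret N: prob_space N by fact
  have "(\<integral>\<^sup>+x. h x \<partial>M) \<noteq> 0"
  proof
    assume "(\<integral>\<^sup>+x. h x \<partial>M) = 0"
    then have "AE x in M. h x = 0" by (subst (asm) nn_integral_0_iff_AE) auto
    then have "AE x in M. x \<notin> space M"
      by (rule AE_mp) (auto intro!: AE_I2 dest: pos)
    then have "space M \<in> null_sets M"
      by (subst AE_iff_null_sets) simp_all
    then have "space N \<in> null_sets N"
      using assms sets_eq_imp_space_eq[OF assms(2)] by (auto simp: absolutely_continuous_def)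
    then show False by (simp add: N.emeasure_space_1 null_sets_def)
  qed
  define C where "C = (\<integral>\<^sup>+x. h x \<partial>M)"
  have C: "C \<noteq> 0" "C \<noteq> \<infinity>" "C \<noteq> top"
    using fin \<open>(\<integral>\<^sup>+x. h x \<partial>M) \<noteq> 0\<close> by (simp_all add: C_def)
  define \<nu> where "\<nu> = density M (\<lambda>x. h x / C)"
  have "prob_space \<nu>"
  proof
    have "emeasure \<nu> (space \<nu>) = (\<integral>\<^sup>+x. h x / C \<partial>M)"
      by (simp add: \<nu>_def emeasure_density cong: nn_integral_cong)
    also have "\<dots> = C / C"
      by (simp add: nn_integral_divide C_def)
    finally show "emeasure \<nu> (space \<nu>) = 1"
      using C by (simp add: ennreal_divide_self less_top)
  qed
  moreover have "null_sets \<nu> = null_sets M"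
  proof (rule set_eqI)
    fix A
    have "A \<in> null_sets \<nu> \<longleftrightarrow> A \<in> sets M \<and> (AE x in M. x \<in> A \<longrightarrow> h x / C = 0)"
      unfolding \<nu>_def by (rule null_sets_density_iff) measurable
    also have "\<dots> \<longleftrightarrow> A \<in> sets M \<and> (AE x in M. x \<notin> A)"
      using pos C by (intro conj_cong AE_cong) (auto simp: ennreal_divide_eq_0_iff less_le)
    also have "\<dots> \<longleftrightarrow> A \<in> null_sets M"
      by (metis AE_iff_null_sets null_setsD2)
    finally show "A \<in> null_sets \<nu> \<longleftrightarrow> A \<in> null_sets M" .
  qed
  ultimately show ?thesis
    by (intro exI[of _ \<nu>]) (simp add: \<nu>_def)
qed

text \<open>Outcomes are replaced by their families of values, with the largest \<sigma>-algebra
  that makes this map measurable. It keeps the disagreement events, which the product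
  \<sigma>-algebra may miss.\<close>

lemma is_coupling_pushforward:
  fixes M :: "'v measure" and Y :: "'i \<Rightarrow> 'v \<Rightarrow> 'a"
  assumes M: "is_coupling I E P X M Y"
    and neq: "\<And>i j. i \<in> I \<Longrightarrow> j \<in> I \<Longrightarrow> {\<omega> \<in> space M. Y i \<omega> \<noteq> Y j \<omega>} \<in> sets M"
  shows "\<exists>(N :: ('i \<Rightarrow> 'a) measure) X'. is_coupling I E P X N X' \<and>
    (\<forall>i\<in>I. \<forall>j\<in>I. {\<omega> \<in> space N. X' i \<omega> \<noteq> X' j \<omega>} \<in> sets N \<and>
       \<P>(\<omega> in N. X' i \<omega> \<noteq> X' j \<omega>) = \<P>(\<omega> in M. Y i \<omega> \<noteq> Y j \<omega>))"
proof -
  interpret prob_space M using M by (simp add: is_coupling_def)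
  have Y: "Y i \<in> M \<rightarrow>\<^sub>M E" "distr M E (Y i) = distr (P i) E (X i)" if "i \<in> I" for i
    using M that by (auto simp: is_coupling_def)
  define \<Phi> where "\<Phi> \<omega> i = Y i \<omega>" for \<omega> i
  define S where "S = {\<phi>. \<forall>i\<in>I. \<phi> i \<in> space E}"
  define \<Sigma> where "\<Sigma> = {B. B \<subseteq> S \<and> \<Phi> -` B \<inter> space M \<in> sets M}"
  have \<Phi>S: "\<Phi> \<omega> \<in> S" if "\<omega> \<in> space M" for \<omega>
    using that Y(1) by (auto simp: S_def \<Phi>_def dest: measurable_space)
  have "sigma_algebra S \<Sigma>"
    unfolding sigma_algebra_iff2
  proof (intro conjI ballI allI impI)
    show "\<Sigma> \<subseteq> Pow S" by (auto simp: \<Sigma>_def)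
    show "{} \<in> \<Sigma>" by (simp add: \<Sigma>_def)
    show "S - B \<in> \<Sigma>" if "B \<in> \<Sigma>" for B
    proof -
      have "\<Phi> -` (S - B) \<inter> space M = space M - (\<Phi> -` B \<inter> space M)"
        using \<Phi>S by auto
      then show ?thesis using that by (auto simp: \<Sigma>_def)
    qed
    show "(\<Union>n. B n) \<in> \<Sigma>" if "range B \<subseteq> \<Sigma>" for B :: "nat \<Rightarrow> _"
    proof -
      have "\<Phi> -` (\<Union>n. B n) \<inter> space M = (\<Union>n. \<Phi> -` B n \<inter> space M)" by auto
      also have "\<dots> \<in> sets M" using that by (intro sets.countable_UN) (auto simp: \<Sigma>_def)
      finally show ?thesis using that by (auto simp: \<Sigma>_def)
    qed
  qed
  then interpret SA: sigma_algebra S \<Sigma> .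
  define N0 where "N0 = sigma S \<Sigma>"
  have N0: "space N0 = S" "sets N0 = \<Sigma>"
    unfolding N0_def by (simp_all add: SA.space_closed SA.sigma_sets_eq)
  have \<Phi> [measurable]: "\<Phi> \<in> M \<rightarrow>\<^sub>M N0"
    by (rule measurableI) (auto simp: N0 \<Phi>S, auto simp: \<Sigma>_def)
  define N where "N = distr M N0 \<Phi>"
  have N: "space N = S" "sets N = \<Sigma>" by (simp_all add: N_def N0)
  have coord: "(\<lambda>\<phi>. \<phi> i) \<in> N \<rightarrow>\<^sub>M E" if i: "i \<in> I" for i
  proof (rule measurableI)
    fix A assume "A \<in> sets E"
    moreover have "\<Phi> -` ((\<lambda>\<phi>. \<phi> i) -` A \<inter> S) \<inter> space M = Y i -` A \<inter> space M"
      using \<Phi>S by (auto simp: \<Phi>_def)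
    ultimately show "(\<lambda>\<phi>. \<phi> i) -` A \<inter> space N \<in> sets N"
      using measurable_sets[OF Y(1)[OF i]] by (simp add: N \<Sigma>_def)
  qed (use i in \<open>auto simp: N S_def\<close>)
  have "is_coupling I E P X N (\<lambda>i \<phi>. \<phi> i)"
    unfolding is_coupling_def
  proof (intro conjI ballI)
    show "prob_space N" unfolding N_def by (rule prob_space_distr) measurable
    fix i assume i: "i \<in> I"
    show "(\<lambda>\<phi>. \<phi> i) \<in> N \<rightarrow>\<^sub>M E" by (rule coord) fact
    then have "distr N E (\<lambda>\<phi>. \<phi> i) = distr M E (Y i)"
      unfolding N_def by (subst distr_distr) (auto simp: comp_def \<Phi>_def)
    then show "distr N E (\<lambda>\<phi>. \<phi> i) = distr (P i) E (X i)"
      using Y(2)[OF i] by simp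
  qed
  moreover have "{\<phi> \<in> space N. \<phi> i \<noteq> \<phi> j} \<in> sets N \<and>
      \<P>(\<phi> in N. \<phi> i \<noteq> \<phi> j) = \<P>(\<omega> in M. Y i \<omega> \<noteq> Y j \<omega>)" if ij: "i \<in> I" "j \<in> I" for i j
  proof -
    have eq: "\<Phi> -` {\<phi> \<in> S. \<phi> i \<noteq> \<phi> j} \<inter> space M = {\<omega> \<in> space M. Y i \<omega> \<noteq> Y j \<omega>}"
      using \<Phi>S by (auto simp: \<Phi>_def)
    have "{\<phi> \<in> S. \<phi> i \<noteq> \<phi> j} \<in> \<Sigma>"
      unfolding \<Sigma>_def using eq neq[OF ij] by auto
    then show ?thesis
      using eq by (simp add: N) (simp add: N_def measure_distr N0)
  qed
  ultimately show ?thesis by blast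
qed

section \<open>Total variation and the maximum of two densities\<close>

lemma prob_le_tv_dist:
  assumes "prob_space P" "prob_space Q" and A: "A \<in> sets E"
  shows "\<bar>\<P>(\<omega> in P. X \<omega> \<in> A) - \<P>(\<omega> in Q. Y \<omega> \<in> A)\<bar> \<le> tv_dist E P X Q Y"
proof -
  \<comment> \<open>A supremum of reals dominates its terms once they are bounded.\<close>
  have "\<bar>\<P>(\<omega> in P. X \<omega> \<in> B) - \<P>(\<omega> in Q. Y \<omega> \<in> B)\<bar> \<le> 1" for B
    using prob_space.prob_le_1[OF assms(1), of "{\<omega> \<in> space P. X \<omega> \<in> B}"]
      prob_space.prob_le_1[OF assms(2), of "{\<omega> \<in> space Q. Y \<omega> \<in> B}"]
      measure_nonneg[of P "{\<omega> \<in> space P. X \<omega> \<in> B}"] measure_nonneg[of Q "{\<omega> \<in> space Q. Y \<omega> \<in> B}"]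
    by linarith
  then show ?thesis
    unfolding tv_dist_def using A by (intro cSUP_upper bdd_aboveI2[of _ _ 1]) auto
qed

text \<open>On \<open>A\<close>, where \<open>f\<close> dominates, the maximum is the density of
  \<open>X\<close>, off \<open>A\<close> that of \<open>Y\<close>. The integral is thus
  \<open>1\<close> plus the difference of the two probabilities of \<open>A\<close>, which the
  supremum bounds.\<close>

lemma nn_integral_max_density_le_tv_dist:
  assumes [measurable]: "f \<in> borel_measurable M" "g \<in> borel_measurable M"
    and P: "prob_space P" "X \<in> P \<rightarrow>\<^sub>M E" and Q: "prob_space Q" "Y \<in> Q \<rightarrow>\<^sub>M E"
    and sets: "sets M = sets E"
    and f: "density M f = distr P E X" and g: "density M g = distr Q E Y"
  shows "(\<integral>\<^sup>+x. max (f x) (g x) \<partial>M) \<le> ennreal (1 + tv_dist E P X Q Y)"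
proof -
  interpret P: prob_space P by fact
  interpret Q: prob_space Q by fact
  define A where "A = {x \<in> space M. g x \<le> f x}"
  have A [measurable]: "A \<in> sets M" unfolding A_def by measurable
  have AE: "A \<in> sets E" "space M - A \<in> sets E" using A sets by auto
  have sp: "space M = space E" using sets by (rule sets_eq_imp_space_eq)
  have "(\<integral>\<^sup>+x. max (f x) (g x) \<partial>M) = (\<integral>\<^sup>+x. f x * indicator A x + g x * indicator (space M - A) x \<partial>M)"
    by (intro nn_integral_cong) (auto simp: A_def max_def split: split_indicator)
  also have "\<dots> = emeasure (density M f) A + emeasure (density M g) (space M - A)"
    by (subst nn_integral_add) (auto simp: emeasure_density)
  also have "\<dots> = ennreal (\<P>(\<omega> in P. X \<omega> \<in> A)) + ennreal (\<P>(\<omega> in Q. Y \<omega> \<in> space M - A))"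
    unfolding f g using P Q AE
    by (simp add: emeasure_distr P.emeasure_eq_measure Q.emeasure_eq_measure vimage_def Int_def conj_commute)
  also have "\<P>(\<omega> in Q. Y \<omega> \<in> space M - A) = 1 - \<P>(\<omega> in Q. Y \<omega> \<in> A)"
  proof -
    have "{\<omega> \<in> space Q. Y \<omega> \<in> space M - A} = space Q - {\<omega> \<in> space Q. Y \<omega> \<in> A}"
      using measurable_space[OF Q(2)] by (auto simp: sp)
    moreover have "{\<omega> \<in> space Q. Y \<omega> \<in> A} \<in> sets Q"
      using measurable_sets[OF Q(2) AE(1)] by (simp add: vimage_def Int_def conj_commute)
    ultimately show ?thesis by (simp add: Q.prob_compl)
  qed
  also have "ennreal (\<P>(\<omega> in P. X \<omega> \<in> A)) + ennreal (1 - \<P>(\<omega> in Q. Y \<omega> \<in> A))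
      = ennreal (1 + (\<P>(\<omega> in P. X \<omega> \<in> A) - \<P>(\<omega> in Q. Y \<omega> \<in> A)))"
    by (subst ennreal_plus[symmetric]) (auto simp: algebra_simps)
  also have "\<dots> \<le> ennreal (1 + tv_dist E P X Q Y)"
    using prob_le_tv_dist[OF P(1) Q(1) AE(1), of X Y] by (intro ennreal_leI) simp
  finally show ?thesis .
qed

theorem theorem2:
  fixes I :: "'i set" and E \<mu> :: "'a measure"
    and P :: "'i \<Rightarrow> 'w measure" and X :: "'i \<Rightarrow> 'w \<Rightarrow> 'a"
  assumes "\<And>i. i \<in> I \<Longrightarrow> prob_space (P i)"
    and "\<And>i. i \<in> I \<Longrightarrow> X i \<in> P i \<rightarrow>\<^sub>M E"
    and "sigma_finite_measure \<mu>" and "sets \<mu> = sets E"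
    and "\<And>i. i \<in> I \<Longrightarrow> absolutely_continuous \<mu> (distr (P i) E (X i))"
  shows "\<exists>(N :: ('i \<Rightarrow> 'a) measure) X'. is_coupling I E P X N X' \<and>
    (\<forall>i\<in>I. \<forall>j\<in>I.
       {\<omega> \<in> space N. X' i \<omega> \<noteq> X' j \<omega>} \<in> sets N \<and>
       \<P>(\<omega> in N. X' i \<omega> \<noteq> X' j \<omega>)
         \<le> 2 * tv_dist E (P i) (X i) (P j) (X j) / (1 + tv_dist E (P i) (X i) (P j) (X j)))"
proof (cases "I = {}")
  case True
  \<comment> \<open>With no variables there is no law to exclude \<open>\<mu> = 0\<close>, and any
    probability space serves.\<close>
  have "is_coupling I E P X (return (count_space UNIV) undefined) (\<lambda>_ _. undefined)"
    using True by (auto simp: is_coupling_def intro: prob_space_return)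
  then show ?thesis using True by blast
next
  case False
  then obtain i0 where i0: "i0 \<in> I" by auto
  interpret \<mu>: sigma_finite_measure \<mu> by fact
  have law: "prob_space (distr (P i) E (X i))" if "i \<in> I" for i
    using assms(1,2) that by (intro prob_space.prob_space_distr)
  \<comment> \<open>Equal null sets keep every law absolutely continuous, now with respect to a
    probability measure.\<close>
  obtain \<nu> where "prob_space \<nu>" and sets: "sets \<nu> = sets E" and null: "null_sets \<nu> = null_sets \<mu>"
    using \<mu>.equivalent_prob_space[OF assms(5)[OF i0] _ law[OF i0]] assms(4) by auto
  interpret \<nu>: prob_space \<nu> by fact
  have "\<exists>f\<in>borel_measurable \<nu>. density \<nu> f = distr (P i) E (X i)" if "i \<in> I" for i
    using assms(5)[OF that] by (intro \<nu>.Radon_Nikodym) (simp_all add: absolutely_continuous_def null sets)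
  then obtain f where f: "\<And>i. i \<in> I \<Longrightarrow> f i \<in> borel_measurable \<nu>"
    and dens: "\<And>i. i \<in> I \<Longrightarrow> density \<nu> (f i) = distr (P i) E (X i)"
    by metis
  have int: "(\<integral>\<^sup>+x. f i x \<partial>\<nu>) = 1" if i: "i \<in> I" for i
  proof -
    have "(\<integral>\<^sup>+x. f i x \<partial>\<nu>) = emeasure (density \<nu> (f i)) (space \<nu>)"
      using f[OF i] by (simp add: emeasure_density cong: nn_integral_cong)
    also have "\<dots> = 1"
      unfolding dens[OF i] using prob_space.emeasure_space_1[OF law[OF i]] sets_eq_imp_space_eq[OF sets] by simp
    finally show ?thesis .
  qed
  obtain D where D: "resolves \<nu> D" using \<nu>.resolves_exists by blast
  then have rD: "range D \<subseteq> sets \<nu>" by (simp add: resolves_def)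
  interpret L: prob_space "area_law \<nu>" by (rule \<nu>.prob_space_area_law)
  let ?R = "strips (area_law \<nu>)"
  let ?Y = "\<lambda>i. sample \<nu> D (f i)"
  have "is_coupling I E P X ?R ?Y"
    unfolding is_coupling_def
  proof (intro conjI ballI)
    show "prob_space ?R" by (rule L.prob_space_strips)
    fix i assume i: "i \<in> I"
    have "?Y i \<in> ?R \<rightarrow>\<^sub>M \<nu>" by (rule measurable_sample[OF f[OF i] rD])
    then show "?Y i \<in> ?R \<rightarrow>\<^sub>M E" using measurable_cong_sets[OF refl sets] by blast
    have "distr ?R E (?Y i) = distr ?R \<nu> (?Y i)" by (rule distr_cong) (simp_all add: sets)
    then show "distr ?R E (?Y i) = distr (P i) E (X i)"
      using \<nu>.distr_sample[OF f[OF i] D int[OF i]] dens[OF i] by simp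
  qed
  moreover have "{\<omega> \<in> space ?R. ?Y i \<omega> \<noteq> ?Y j \<omega>} \<in> sets ?R" if "i \<in> I" "j \<in> I" for i j
    by (rule \<nu>.sets_sample_neq[OF f f rD]) fact+
  \<comment> \<open>The coupling on strips is moved to the outcome type
    \<open>'i \<Rightarrow> 'a\<close>.\<close>
  ultimately obtain N :: "('i \<Rightarrow> 'a) measure" and X' where N: "is_coupling I E P X N X'"
    and neq: "\<And>i j. i \<in> I \<Longrightarrow> j \<in> I \<Longrightarrow> {\<omega> \<in> space N. X' i \<omega> \<noteq> X' j \<omega>} \<in> sets N \<and>
       \<P>(\<omega> in N. X' i \<omega> \<noteq> X' j \<omega>) = \<P>(\<omega> in ?R. ?Y i \<omega> \<noteq> ?Y j \<omega>)"
    using is_coupling_pushforward[of I E P X ?R ?Y] by blast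
  have "\<P>(\<omega> in ?R. ?Y i \<omega> \<noteq> ?Y j \<omega>)
      \<le> 2 * tv_dist E (P i) (X i) (P j) (X j) / (1 + tv_dist E (P i) (X i) (P j) (X j))"
    if ij: "i \<in> I" "j \<in> I" for i j
  proof -
    define d where "d = tv_dist E (P i) (X i) (P j) (X j)"
    have d: "0 \<le> d"
      using prob_le_tv_dist[OF assms(1)[OF ij(1)] assms(1)[OF ij(2)], of "{}" E "X i" "X j"]
      by (simp add: d_def)
    have le: "(\<integral>\<^sup>+x. max (f i x) (f j x) \<partial>\<nu>) \<le> ennreal (1 + d)"
      unfolding d_def by (intro nn_integral_max_density_le_tv_dist f dens assms(1,2) sets ij)
    \<comment> \<open>The bound makes the integral finite, hence a real number.\<close>
    then obtain c where c: "(\<integral>\<^sup>+x. max (f i x) (f j x) \<partial>\<nu>) = ennreal c" "0 \<le> c" "c \<le> 1 + d"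
      using d by (cases "\<integral>\<^sup>+x. max (f i x) (f j x) \<partial>\<nu>" rule: ennreal_cases) (auto simp: top_unique simp del: ennreal_plus)
    have "(\<integral>\<^sup>+x. f i x \<partial>\<nu>) \<le> (\<integral>\<^sup>+x. max (f i x) (f j x) \<partial>\<nu>)"
      by (intro nn_integral_mono) simp
    then have "1 \<le> c" using int[OF ij(1)] c by simp
    have "\<P>(\<omega> in ?R. ?Y i \<omega> \<noteq> ?Y j \<omega>) \<le> 2 - 2 / c"
      by (rule \<nu>.prob_sample_neq[OF f f rD int int c(1,2)]) fact+
    \<comment> \<open>\<open>2 - 2 / c\<close> increases with \<open>c\<close>.\<close>
    also have "\<dots> \<le> 2 - 2 / (1 + d)"
      using c(3) \<open>1 \<le> c\<close> by (intro diff_left_mono divide_left_mono) auto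
    also have "\<dots> = 2 * d / (1 + d)"
      using d by (simp add: field_simps)
    finally show ?thesis unfolding d_def .
  qed
  then show ?thesis
    using N neq by (intro exI[of _ N] exI[of _ X']) auto
qed

end
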